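(* Let $d\in(0,\tfrac14)$. In the square model at density $d$ a random group is free with overwhelming probability.
   Context: Square model: for $n\ge 1$ let $A_n=\{a_1,\dots,a_n\}$, let $F_n$ be the free group on $A_n$, and let $W'_n$ be the set of all cyclically reduced words of length four in the letters $a_i^{\pm1}$. For $d\in(0,1)$ choose a subset $R_n\subset W'_n$ with $|R_n|=\lfloor (2n-1)^{4d}\rfloor$ uniformly at random among all subsets of that size. The quotient $G=\langle A_n\mid R_n\rangle$ of $F_n$ by the normal closure of $R_n$ is a random group in the square model at density $d$. A property holds with overwhelming probability if the probability that the random group has it tends to $1$ as $n\to\infty$. *)

theory Defs
  imports "HOL-Probability.Probability_Mass_Function" "HOL-Algebra.Coset"
begin

text \<open>\<open>(a, True)\<close> is the letter \<open>a\<close>, and \<open>(a, False)\<close> is the letter \<open>a\<inverse>\<close>.\<close>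

type_synonym 'a letter = "'a \<times> bool"
type_synonym 'a word = "'a letter list"

definition inv_letter :: "'a letter \<Rightarrow> 'a letter" where
  "inv_letter x = (fst x, \<not> snd x)"

definition reduced :: "'a word \<Rightarrow> bool" where
  "reduced w \<longleftrightarrow> (\<forall>i. Suc i < length w \<longrightarrow> w ! Suc i \<noteq> inv_letter (w ! i))"

definition cyclically_reduced :: "'a word \<Rightarrow> bool" where
  "cyclically_reduced w \<longleftrightarrow> reduced w \<and> (w \<noteq> [] \<longrightarrow> hd w \<noteq> inv_letter (last w))"

fun cons_reduce :: "'a letter \<Rightarrow> 'a word \<Rightarrow> 'a word" where
  "cons_reduce x [] = [x]"
| "cons_reduce x (y # w) = (if y = inv_letter x then w else x # y # w)"

definition reduce :: "'a word \<Rightarrow> 'a word" where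
  "reduce w = foldr cons_reduce w []"

definition free_group :: "'a set \<Rightarrow> 'a word monoid" where
  "free_group A = \<lparr>carrier = {w. reduced w \<and> fst ` set w \<subseteq> A},
                   mult = (\<lambda>u v. reduce (u @ v)), one = []\<rparr>"

text \<open>
  A basis of a free group is a subset of its carrier, so letting the basis \<open>S\<close> range over
  sets of elements of the carrier type of \<open>G\<close> is no restriction.
  The trivial group is free (\<open>S = {}\<close>).
\<close>

definition is_free_group :: "('g, 'm) monoid_scheme \<Rightarrow> bool" where
  "is_free_group G \<longleftrightarrow> group G \<and> (\<exists>S :: 'g set. free_group S \<cong> G)"

definition normal_closure :: "('g, 'm) monoid_scheme \<Rightarrow> 'g set \<Rightarrow> 'g set" where
  "normal_closure G R = \<Inter> {N. N \<lhd> G \<and> R \<subseteq> N}"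

definition presented_group :: "'a set \<Rightarrow> 'a word set \<Rightarrow> 'a word set monoid" where
  "presented_group A R = free_group A Mod normal_closure (free_group A) R"

definition gens :: "nat \<Rightarrow> nat set" where
  "gens n = {1..n}"

definition square_words :: "nat \<Rightarrow> nat word set" where
  "square_words n = {w. length w = 4 \<and> fst ` set w \<subseteq> gens n \<and> cyclically_reduced w}"

definition relator_sets :: "nat \<Rightarrow> real \<Rightarrow> nat word set set" where
  "relator_sets n d =
     {R. R \<subseteq> square_words n \<and> card R = nat \<lfloor>(2 * real n - 1) powr (4 * d)\<rfloor>}"

definition square_model :: "nat \<Rightarrow> real \<Rightarrow> nat word set pmf" where
  "square_model n d = pmf_of_set (relator_sets n d)"

definition overwhelming_probability_square ::
    "real \<Rightarrow> (nat word set monoid \<Rightarrow> bool) \<Rightarrow> bool" where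
  "overwhelming_probability_square d P \<longleftrightarrow>
     (\<lambda>n. measure_pmf.prob (square_model n d) {R. P (presented_group (gens n) R)})
       \<longlonglongrightarrow> 1"

lemma inv_letter_inv_letter [simp]: "inv_letter (inv_letter x) = x"
  by (simp add: inv_letter_def)

lemma inv_letter_neq [simp]: "inv_letter x \<noteq> x" "x \<noteq> inv_letter x"
  by (auto simp: inv_letter_def prod_eq_iff)

lemma fst_inv_letter [simp]: "fst (inv_letter x) = fst x"
  by (simp add: inv_letter_def)

lemma inv_letter_eq_iff [simp]: "inv_letter x = inv_letter y \<longleftrightarrow> x = y"
  by (metis inv_letter_inv_letter)

lemma reduced_Nil [simp]: "reduced []"
  by (simp add: reduced_def)

lemma reduced_Cons:
  "reduced (x # w) \<longleftrightarrow> reduced w \<and> (w \<noteq> [] \<longrightarrow> hd w \<noteq> inv_letter x)"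
proof (cases w)
  case (Cons y v)
  have "(\<forall>i. Suc i < length (x # w) \<longrightarrow> (x # w) ! Suc i \<noteq> inv_letter ((x # w) ! i)) \<longleftrightarrow>
      w ! 0 \<noteq> inv_letter x \<and> (\<forall>i. Suc i < length w \<longrightarrow> w ! Suc i \<noteq> inv_letter (w ! i))"
    (is "(\<forall>i. ?P i) \<longleftrightarrow> _")
  proof -
    have "(\<forall>i. ?P i) \<longleftrightarrow> ?P 0 \<and> (\<forall>i. ?P (Suc i))"
      by (metis not0_implies_Suc)
    then show ?thesis using Cons by simp
  qed
  then show ?thesis
    using Cons unfolding reduced_def by (simp add: conj_commute)
qed (simp add: reduced_def)

lemma reduced_cons_reduce: "reduced w \<Longrightarrow> reduced (cons_reduce x w)"
  by (cases w) (auto simp: reduced_Cons)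

lemma cons_reduce_cancel: "reduced w \<Longrightarrow> cons_reduce (inv_letter x) (cons_reduce x w) = w"
  by (cases w; cases "tl w") (auto simp: reduced_Cons)

lemma reduced_foldr: "reduced v \<Longrightarrow> reduced (foldr cons_reduce u v)"
  by (induction u) (auto intro: reduced_cons_reduce)

lemma reduced_reduce: "reduced (reduce w)"
  by (simp add: reduce_def reduced_foldr)

lemma reduce_reduced: "reduced w \<Longrightarrow> reduce w = w"
proof (induction w)
  case (Cons x w)
  then show ?case by (cases w) (auto simp: reduce_def reduced_Cons)
qed (simp add: reduce_def)

lemma foldr_cons_reduce:
  assumes "reduced u" "reduced v"
  shows "foldr cons_reduce (cons_reduce x u) v = cons_reduce x (foldr cons_reduce u v)"
proof (cases u)
  case (Cons y t)
  have "reduced (foldr cons_reduce t v)" using assms by (intro reduced_foldr)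
  then show ?thesis
    using Cons cons_reduce_cancel[of "foldr cons_reduce t v" "inv_letter x"] by auto
qed simp

lemma foldr_reduce:
  assumes "reduced v"
  shows "foldr cons_reduce (reduce u) v = foldr cons_reduce u v"
  using assms by (induction u) (auto simp: reduce_def foldr_cons_reduce reduced_foldr)

lemma reduce_append: "reduced v \<Longrightarrow> reduce (u @ v) = foldr cons_reduce u v"
  using reduce_reduced[of v] by (simp add: reduce_def)

lemma set_cons_reduce: "set (cons_reduce x w) \<subseteq> insert x (set w)"
  by (cases w) auto

lemma set_reduce: "set (reduce w) \<subseteq> set w"
  unfolding reduce_def by (induction w) (use set_cons_reduce in fastforce)+

lemma foldr_inverse:
  "reduced v \<Longrightarrow> foldr cons_reduce (rev (map inv_letter w)) (foldr cons_reduce w v) = v"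
  by (induction w) (auto simp: cons_reduce_cancel reduced_foldr)

theorem group_free_group: "group (free_group A)"
proof (rule groupI)
  fix x y assume "x \<in> carrier (free_group A)" "y \<in> carrier (free_group A)"
  then show "x \<otimes>\<^bsub>free_group A\<^esub> y \<in> carrier (free_group A)"
    using set_reduce[of "x @ y"] by (fastforce simp: free_group_def reduced_reduce)
next
  show "\<one>\<^bsub>free_group A\<^esub> \<in> carrier (free_group A)"
    by (simp add: free_group_def)
next
  fix x y z
  assume "x \<in> carrier (free_group A)" "y \<in> carrier (free_group A)" "z \<in> carrier (free_group A)"
  then have "reduced y" "reduced z"
    by (auto simp: free_group_def)
  then show "x \<otimes>\<^bsub>free_group A\<^esub> y \<otimes>\<^bsub>free_group A\<^esub> z =
      x \<otimes>\<^bsub>free_group A\<^esub> (y \<otimes>\<^bsub>free_group A\<^esub> z)"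
    by (simp add: free_group_def reduce_append foldr_reduce reduced_foldr
        del: append_assoc) (metis foldr_append foldr_reduce reduce_append)
next
  fix x assume x: "x \<in> carrier (free_group A)"
  then show "\<one>\<^bsub>free_group A\<^esub> \<otimes>\<^bsub>free_group A\<^esub> x = x"
    by (simp add: free_group_def reduce_reduced)
  let ?y = "reduce (rev (map inv_letter x))"
  have "?y \<in> carrier (free_group A)"
    using x set_reduce[of "rev (map inv_letter x)"]
    by (force simp: free_group_def reduced_reduce)
  moreover have "?y \<otimes>\<^bsub>free_group A\<^esub> x = \<one>\<^bsub>free_group A\<^esub>"
    using x foldr_inverse[of "[]" x] reduce_reduced[of x]
    by (simp add: free_group_def reduce_append foldr_reduce) (simp add: reduce_def)
  ultimately show "\<exists>y\<in>carrier (free_group A).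
      y \<otimes>\<^bsub>free_group A\<^esub> x = \<one>\<^bsub>free_group A\<^esub>"
    by blast
qed

lemma square_words_subset: "square_words n \<subseteq> carrier (free_group (gens n))"
  by (auto simp: square_words_def free_group_def cyclically_reduced_def)

lemma finite_square_words: "finite (square_words n)"
proof (rule finite_subset)
  show "square_words n \<subseteq> {w. set w \<subseteq> gens n \<times> UNIV \<and> length w = 4}"
    by (force simp: square_words_def)
  show "finite {w. set w \<subseteq> gens n \<times> (UNIV :: bool set) \<and> length w = 4}"
    by (rule finite_lists_length_eq) (simp add: gens_def)
qed

lemma finite_relator_sets: "finite (relator_sets n d)"
  unfolding relator_sets_def
  by (rule finite_subset[of _ "Pow (square_words n)"]) (auto simp: finite_square_words)

lemma relator_sets_nonempty:
  assumes "n \<ge> 1" "d \<le> 1/4"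
  shows "relator_sets n d \<noteq> {}"
proof -
  have "(2 * real n - 1) powr (4 * d) \<le> (2 * real n - 1) powr 1"
    using assms by (intro powr_mono) auto
  also have "\<dots> \<le> real (2 * n)"
    using assms by simp
  finally have m: "nat \<lfloor>(2 * real n - 1) powr (4 * d)\<rfloor> \<le> 2 * n"
    by linarith
  have "inj_on (replicate 4) (gens n \<times> (UNIV :: bool set))"
    by (auto simp: inj_on_def)
  then have "card (replicate 4 ` (gens n \<times> (UNIV :: bool set))) = 2 * n"
    by (simp add: card_image card_cartesian_product gens_def)
  moreover have "replicate 4 ` (gens n \<times> UNIV) \<subseteq> square_words n"
    by (auto simp: square_words_def cyclically_reduced_def reduced_def)
  ultimately have "2 * n \<le> card (square_words n)"
    by (metis card_mono finite_square_words)
  with m obtain R where "R \<subseteq> square_words n"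
      "card R = nat \<lfloor>(2 * real n - 1) powr (4 * d)\<rfloor>"
    by (meson obtain_subset_with_card_n order_trans)
  then show ?thesis
    by (auto simp: relator_sets_def)
qed

end

theory Submission
  imports Defs "HOL-Real_Asymp.Real_Asymp"
begin

text \<open>
  If a generator \<open>a\<close> occurs exactly once in a relator \<open>r\<close> and in no other relator, then \<open>r = 1\<close> can be
  solved for \<open>a\<close>, so \<open>a\<close> and \<open>r\<close> can be removed together. If every nonempty set of \<open>k\<close> relators of
  length four involves more than \<open>2k\<close> generators, counting the \<open>4k\<close> letter occurrences shows that
  such an \<open>a\<close> always exists, and all relators can be eliminated. A first moment bound shows that
  this holds with overwhelming probability: with \<open>m\<close> relators, the expected number of
  \<open>k\<close>-element sets of relators on at most \<open>2k\<close> generators is at most \<open>(C m\<^sup>2 / n\<^sup>2)\<^sup>k\<close>, and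
  \<open>m = o(n)\<close> because \<open>4d < 1\<close>.
\<close>


section \<open>Evaluation of words and the universal property of free groups\<close>

text \<open>Defined on all words, reduced or not, so that compatibility with concatenation and
  invariance under \<open>reduce\<close> can be proved separately and combined in
  \<open>evaluate_hom\<close>.\<close>

definition evaluate :: "('g, 'm) monoid_scheme \<Rightarrow> ('a \<Rightarrow> 'g) \<Rightarrow> 'a word \<Rightarrow> 'g" where
  "evaluate G f w =
     foldr (\<lambda>x g. (if snd x then f (fst x) else inv\<^bsub>G\<^esub> f (fst x)) \<otimes>\<^bsub>G\<^esub> g) w \<one>\<^bsub>G\<^esub>"

lemma evaluate_Nil [simp]: "evaluate G f [] = \<one>\<^bsub>G\<^esub>"
  by (simp add: evaluate_def)

lemma evaluate_Cons:
  "evaluate G f (x # w) =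
     (if snd x then f (fst x) else inv\<^bsub>G\<^esub> f (fst x)) \<otimes>\<^bsub>G\<^esub> evaluate G f w"
  by (simp add: evaluate_def)

lemma mem_free_group: "w \<in> carrier (free_group A) \<longleftrightarrow> reduced w \<and> fst ` set w \<subseteq> A"
  by (simp add: free_group_def)

lemma mult_free_group [simp]: "u \<otimes>\<^bsub>free_group A\<^esub> v = reduce (u @ v)"
  by (simp add: free_group_def)

lemma one_free_group [simp]: "\<one>\<^bsub>free_group A\<^esub> = []"
  by (simp add: free_group_def)

lemma free_group_mono: "A \<subseteq> B \<Longrightarrow> carrier (free_group A) \<subseteq> carrier (free_group B)"
  by (auto simp: free_group_def)

lemma reduce_Cons: "reduce (x # w) = cons_reduce x (reduce w)"
  by (simp add: reduce_def)

lemma inv_free_group_letter: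
  assumes "a \<in> A"
  shows "inv\<^bsub>free_group A\<^esub> [(a, s)] = [(a, \<not> s)]"
proof -
  interpret group "free_group A" by (rule group_free_group)
  have "[(a, \<not> s)] \<otimes>\<^bsub>free_group A\<^esub> [(a, s)] = \<one>\<^bsub>free_group A\<^esub>"
    by (simp add: reduce_def inv_letter_def)
  then show ?thesis
    using assms by (intro inv_equality) (auto simp: mem_free_group reduced_Cons)
qed

lemma reduced_infix: "reduced (u @ v) \<Longrightarrow> reduced u \<and> reduced v"
  by (induction u) (auto simp: reduced_Cons)

lemma (in group) evaluate_closed:
  "f ` fst ` set w \<subseteq> carrier G \<Longrightarrow> evaluate G f w \<in> carrier G"
  by (induction w) (auto simp: evaluate_Cons)

lemma (in group) evaluate_append:
  "f ` fst ` set u \<subseteq> carrier G \<Longrightarrow> f ` fst ` set v \<subseteq> carrier G \<Longrightarrow>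
    evaluate G f (u @ v) = evaluate G f u \<otimes> evaluate G f v"
  by (induction u) (auto simp: evaluate_Cons evaluate_closed m_assoc)

lemma (in group) evaluate_cons_reduce:
  "f (fst x) \<in> carrier G \<Longrightarrow> f ` fst ` set w \<subseteq> carrier G \<Longrightarrow>
    evaluate G f (cons_reduce x w) = evaluate G f (x # w)"
  by (cases w) (auto simp: evaluate_Cons inv_letter_def evaluate_closed m_assoc[symmetric])

lemma (in group) evaluate_reduce:
  "f ` fst ` set w \<subseteq> carrier G \<Longrightarrow> evaluate G f (reduce w) = evaluate G f w"
proof (induction w)
  case (Cons x w)
  have "f ` fst ` set (reduce w) \<subseteq> carrier G"
    using Cons.prems set_reduce[of w] by fastforce
  then show ?case
    using Cons by (simp add: reduce_Cons evaluate_cons_reduce evaluate_Cons)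
qed (simp add: reduce_def)

lemma (in group) evaluate_hom:
  assumes "f ` A \<subseteq> carrier G"
  shows "evaluate G f \<in> hom (free_group A) G"
proof (rule homI)
  fix u v assume "u \<in> carrier (free_group A)" "v \<in> carrier (free_group A)"
  then have *: "f ` fst ` set u \<subseteq> carrier G" "f ` fst ` set v \<subseteq> carrier G"
    using assms unfolding mem_free_group by (blast dest: subsetD)+
  then show "evaluate G f u \<in> carrier G"
    by (intro evaluate_closed)
  show "evaluate G f (u \<otimes>\<^bsub>free_group A\<^esub> v) = evaluate G f u \<otimes> evaluate G f v"
    using * by (simp add: evaluate_reduce image_Un evaluate_append)
qed

text \<open>Induction on the word: a reduced \<open>x # w\<close> is the product of
  \<open>[x]\<close> and \<open>w\<close> without any cancellation. With \<open>evaluate_hom\<close>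
  for existence, this gives the uniqueness half of the universal property.\<close>

lemma (in group) hom_eq_evaluate:
  assumes h: "h \<in> hom (free_group A) G" and "w \<in> carrier (free_group A)"
  shows "h w = evaluate G (\<lambda>a. h [(a, True)]) w"
  using assms(2)
proof (induction w)
  case Nil
  then show ?case
    using hom_one[OF h group_free_group is_group] by simp
next
  case (Cons x w)
  interpret h: group_hom "free_group A" G h
    using h by (intro group_hom.intro group_free_group is_group group_hom_axioms.intro)
  from Cons.prems have w: "w \<in> carrier (free_group A)" and a: "fst x \<in> A"
    by (auto simp: mem_free_group reduced_Cons)
  have x: "[(fst x, s)] \<in> carrier (free_group A)" for s
    using a by (auto simp: mem_free_group reduced_Cons)
  have "x # w = [x] \<otimes>\<^bsub>free_group A\<^esub> w"
    using Cons.prems by (simp add: reduce_reduced mem_free_group)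
  then have "h (x # w) = h [x] \<otimes> h w"
    using h.hom_mult[of "[x]" w] x[of "snd x"] w by simp
  moreover have "h [x] = (if snd x then h [(fst x, True)] else inv h [(fst x, True)])"
    using h.hom_inv[OF x[of True]] inv_free_group_letter[OF a, of True]
    by (cases x) auto
  ultimately show ?case
    using Cons.IH[OF w] by (simp add: evaluate_Cons)
qed

lemma evaluate_cong:
  "(\<And>a. a \<in> fst ` set w \<Longrightarrow> f a = g a) \<Longrightarrow> evaluate G f w = evaluate G g w"
  by (induction w) (auto simp: evaluate_Cons)

lemma (in group) hom_free_group_unique:
  assumes "h \<in> hom (free_group A) G" "k \<in> hom (free_group A) G"
    and "\<And>a. a \<in> A \<Longrightarrow> h [(a, True)] = k [(a, True)]" and "w \<in> carrier (free_group A)"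
  shows "h w = k w"
  using assms hom_eq_evaluate[of h A w] hom_eq_evaluate[of k A w]
  by (auto simp: mem_free_group intro!: evaluate_cong)

text \<open>Multiplication and unit of \<open>free_group A\<close> do not depend on
  \<open>A\<close>, so a homomorphism can be restricted to fewer generators without changing the
  function.\<close>

lemma hom_free_group_mono:
  assumes "h \<in> hom (free_group A) G" "B \<subseteq> A"
  shows "h \<in> hom (free_group B) G"
  using assms free_group_mono[of B A] by (force simp: hom_def)

lemma hom_free_group_codomain_mono:
  assumes "h \<in> hom G (free_group B)" "B \<subseteq> A"
  shows "h \<in> hom G (free_group A)"
  using assms free_group_mono[of B A] by (force simp: hom_def)

lemma letter_in_free_group [simp]: "[(a, s)] \<in> carrier (free_group A) \<longleftrightarrow> a \<in> A"
  by (simp add: mem_free_group reduced_Cons)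

text \<open>Puts the value of a relator into the shape \<open>u x v\<close>, with \<open>x\<close>
  the value of one distinguished letter. This is the equation that is later solved for the generator
  \<open>a\<close>.\<close>

lemma (in group) hom_split:
  assumes h: "h \<in> hom (free_group A) G"
    and r: "u @ (a, s) # v \<in> carrier (free_group A)"
  shows "h (u @ (a, s) # v) =
    h u \<otimes> ((if s then h [(a, True)] else inv h [(a, True)]) \<otimes> h v)"
proof -
  have a: "u \<in> carrier (free_group A)" "v \<in> carrier (free_group A)" "a \<in> A"
    using r reduced_infix[of u "(a, s) # v"] by (auto simp: mem_free_group reduced_Cons)
  have c: "h [(b, True)] \<in> carrier G" if "b \<in> A" for b
    using h that by (auto simp: hom_def Pi_def)
  show ?thesis
    using a c r unfolding hom_eq_evaluate[OF h r] hom_eq_evaluate[OF h a(1)] hom_eq_evaluate[OF h a(2)]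
    by (subst evaluate_append) (auto simp: mem_free_group evaluate_Cons image_subset_iff)
qed

text \<open>Uniqueness of the solution of \<open>u x v = 1\<close>: a homomorphism that kills a
  relator has no choice for the value of the eliminated generator.\<close>

lemma (in group) eq_middle_if_mult_eq_one:
  assumes "u \<in> carrier G" "v \<in> carrier G" "x \<in> carrier G" "y \<in> carrier G"
    and "u \<otimes> (x \<otimes> v) = \<one>" "u \<otimes> (y \<otimes> v) = \<one>"
  shows "x = y"
proof -
  have "x \<otimes> v = y \<otimes> v"
    using assms Units_l_cancel[of u "x \<otimes> v" "y \<otimes> v"] by simp
  then show ?thesis
    using assms by simp
qed

section \<open>Eliminating generators and relators one pair at a time\<close>

text \<open>Read from the last insertion backwards, this is the order of elimination. The generator
  \<open>a\<close> must be absent only from the relators that remain; relators eliminated earlier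
  may contain it.\<close>

inductive collapsible :: "'a word set \<Rightarrow> bool" where
  empty: "collapsible {}"
| insert: "collapsible R \<Longrightarrow> a \<notin> (\<Union>w\<in>R. fst ` set w) \<Longrightarrow> a \<notin> fst ` set (u @ v) \<Longrightarrow>
    collapsible (insert (u @ (a, s) # v) R)"

text \<open>
  The retraction comes with a test group \<open>Q\<close> instead of the statement that its kernel is the normal
  closure of \<open>R\<close>: this passes through the induction without comparing normal closures in
  free groups on different generating sets.
\<close>

lemma collapsible_retraction:
  assumes "collapsible R" "R \<subseteq> carrier (free_group A)" "group Q"
  shows "\<exists>B \<phi>. B \<subseteq> A \<and> \<phi> \<in> hom (free_group A) (free_group B) \<and>
    (\<forall>w\<in>carrier (free_group B). \<phi> w = w) \<and> (\<forall>r\<in>R. \<phi> r = []) \<and>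
    (\<forall>\<psi>\<in>hom (free_group A) Q. (\<forall>r\<in>R. \<psi> r = \<one>\<^bsub>Q\<^esub>) \<longrightarrow>
       (\<forall>w\<in>carrier (free_group A). \<psi> (\<phi> w) = \<psi> w))"
  using assms(1,2)
proof (induction arbitrary: A)
  case empty
  show ?case
    by (intro exI[of _ A] exI[of _ "\<lambda>w. w"]) (auto simp: hom_def)
next
  case (insert R a u v s)
  let ?r = "u @ (a, s) # v" and ?A = "A - {a}"
  interpret Q: group Q by fact
  have r: "?r \<in> carrier (free_group A)"
    using insert.prems by blast
  have uv: "u \<in> carrier (free_group ?A)" "v \<in> carrier (free_group ?A)" "a \<in> A"
    using r insert.hyps(3) reduced_infix[of u "(a, s) # v"]
    by (auto simp: mem_free_group reduced_Cons)
  have R: "R \<subseteq> carrier (free_group ?A)"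
  proof
    fix r assume "r \<in> R"
    then have "a \<notin> fst ` set r" "r \<in> carrier (free_group A)"
      using insert.prems insert.hyps(2) by auto
    then show "r \<in> carrier (free_group ?A)"
      unfolding mem_free_group by blast
  qed
  obtain B \<phi> where B: "B \<subseteq> ?A" and \<phi>: "\<phi> \<in> hom (free_group ?A) (free_group B)"
    and *: "\<forall>w\<in>carrier (free_group B). \<phi> w = w" "\<forall>r\<in>R. \<phi> r = []"
      "\<forall>\<psi>\<in>hom (free_group ?A) Q. (\<forall>r\<in>R. \<psi> r = \<one>\<^bsub>Q\<^esub>) \<longrightarrow>
        (\<forall>w\<in>carrier (free_group ?A). \<psi> (\<phi> w) = \<psi> w)"
    using insert.IH[OF R] by (elim exE conjE) (rule that)
  have \<phi>_id: "\<phi> w = w" if "w \<in> carrier (free_group B)" for w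
    using *(1) that by blast
  have \<phi>_R: "\<phi> r = []" if "r \<in> R" for r
    using *(2) that by blast
  have \<phi>_univ: "\<psi> (\<phi> w) = \<psi> w" if "\<psi> \<in> hom (free_group ?A) Q"
    "\<forall>r\<in>R. \<psi> r = \<one>\<^bsub>Q\<^esub>" "w \<in> carrier (free_group ?A)" for \<psi> w
    using *(3) that by blast
  interpret FA: group "free_group ?A" by (rule group_free_group)
  interpret FB: group "free_group B" by (rule group_free_group)
  interpret \<phi>: group_hom "free_group ?A" "free_group B" \<phi>
    using \<phi> by unfold_locales
  \<comment> \<open>\<open>c\<close> is the solution for \<open>a\<close> of the relation:
    \<open>u a v = 1\<close> gives the product of the inverses of \<open>u\<close> and
    \<open>v\<close>, while \<open>u a\<inverse> v = 1\<close> gives \<open>v u\<close>. It does not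
    involve \<open>a\<close>.\<close>
  define c where "c = (if s then inv\<^bsub>free_group ?A\<^esub> u \<otimes>\<^bsub>free_group ?A\<^esub> inv\<^bsub>free_group ?A\<^esub> v
    else v \<otimes>\<^bsub>free_group ?A\<^esub> u)"
  have c: "c \<in> carrier (free_group ?A)"
    using uv FA.m_closed FA.inv_closed unfolding c_def by presburger
  \<comment> \<open>The new retraction substitutes \<open>c\<close> for \<open>a\<close> and then
    applies \<open>\<phi>\<close>.\<close>
  define \<phi>' where "\<phi>' = evaluate (free_group B) (\<lambda>x. \<phi> (if x = a then c else [(x, True)]))"
  have \<phi>': "\<phi>' \<in> hom (free_group A) (free_group B)"
    unfolding \<phi>'_def using c \<phi>.hom_closed by (intro FB.evaluate_hom) auto
  have \<phi>'_gen: "\<phi>' [(x, True)] = \<phi> (if x = a then c else [(x, True)])" if "x \<in> A" for x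
    using that c \<phi>.hom_closed FB.r_one[of "\<phi> (if x = a then c else [(x, True)])"]
    by (simp add: \<phi>'_def evaluate_Cons del: mult_free_group one_free_group FB.r_one)
  have \<phi>'_eq: "\<phi>' w = \<phi> w" if "w \<in> carrier (free_group ?A)" for w
    using FB.hom_free_group_unique[OF hom_free_group_mono[OF \<phi>', of ?A] \<phi> _ that] \<phi>'_gen by auto
  \<comment> \<open>The target group is kept arbitrary because the identity is used twice: for
    \<open>\<phi>\<close>, to see that the new retraction kills the relator, and for the test
    homomorphism into \<open>Q\<close>.\<close>
  have solve: "\<psi> u \<otimes>\<^bsub>H\<^esub> ((if s then \<psi> c else inv\<^bsub>H\<^esub> \<psi> c) \<otimes>\<^bsub>H\<^esub> \<psi> v) = \<one>\<^bsub>H\<^esub>"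
    if H: "group H" and \<psi>: "\<psi> \<in> hom (free_group ?A) H" for \<psi> and H :: "('h, 'k) monoid_scheme"
  proof -
    interpret H: group H by fact
    interpret \<psi>: group_hom "free_group ?A" H \<psi>
      using \<psi> by unfold_locales
    have "\<psi> c = (if s then inv\<^bsub>H\<^esub> \<psi> u \<otimes>\<^bsub>H\<^esub> inv\<^bsub>H\<^esub> \<psi> v else \<psi> v \<otimes>\<^bsub>H\<^esub> \<psi> u)"
      using uv by (simp add: c_def del: mult_free_group)
    then show ?thesis
      using uv \<psi>.hom_closed by (simp add: H.inv_mult_group H.m_assoc)
  qed
  have \<phi>'_r: "\<phi>' ?r = []"
    using FB.hom_split[OF \<phi>' r] solve[OF group_free_group \<phi>] \<phi>'_gen[OF uv(3)] \<phi>'_eq uv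
    by (cases s) simp_all
  have "B \<subseteq> A"
    using B by blast
  moreover have "\<phi>' w = w" if "w \<in> carrier (free_group B)" for w
    using that free_group_mono[OF B] \<phi>'_eq \<phi>_id by auto
  moreover have "\<phi>' w = []" if "w \<in> insert ?r R" for w
    using that \<phi>'_r \<phi>'_eq \<phi>_R R by auto
  moreover have "\<psi> (\<phi>' w) = \<psi> w" if \<psi>: "\<psi> \<in> hom (free_group A) Q"
    and \<psi>_R: "\<forall>r\<in>insert ?r R. \<psi> r = \<one>\<^bsub>Q\<^esub>" and w: "w \<in> carrier (free_group A)" for \<psi> w
  proof -
    have \<psi>A: "\<psi> \<in> hom (free_group ?A) Q"
      using \<psi> by (rule hom_free_group_mono) auto
    have cl: "\<psi> x \<in> carrier Q" if "x \<in> carrier (free_group A)" for x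
      using \<psi> that by (auto simp: hom_def)
    \<comment> \<open>It suffices to compare on generators. Away from \<open>a\<close> this is the
      induction hypothesis; at \<open>a\<close>, both \<open>\<psi> [(a, True)]\<close> and
      \<open>\<psi> c\<close> solve the equation given by the relator, so they agree.\<close>
    have "(\<psi> \<circ> \<phi>') w = \<psi> w"
    proof (rule Q.hom_free_group_unique[OF _ \<psi> _ w])
      show "\<psi> \<circ> \<phi>' \<in> hom (free_group A) Q"
        using hom_free_group_codomain_mono[OF \<phi>' \<open>B \<subseteq> A\<close>] \<psi> by (rule hom_compose)
      fix x assume "x \<in> A"
      show "(\<psi> \<circ> \<phi>') [(x, True)] = \<psi> [(x, True)]"
      proof (cases "x = a")
        case False
        then show ?thesis
          using \<phi>_univ[OF \<psi>A, of "[(x, True)]"] \<psi>_R \<open>x \<in> A\<close> \<phi>'_gen by simp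
      next
        case True
        have carr: "\<psi> u \<in> carrier Q" "\<psi> v \<in> carrier Q" "\<psi> c \<in> carrier Q" "\<psi> [(a, True)] \<in> carrier Q"
          using uv c free_group_mono[of ?A A] by (auto intro!: cl)
        have "(if s then \<psi> [(a, True)] else inv\<^bsub>Q\<^esub> \<psi> [(a, True)]) =
            (if s then \<psi> c else inv\<^bsub>Q\<^esub> \<psi> c)"
        proof (rule Q.eq_middle_if_mult_eq_one[OF carr(1,2)])
          show "\<psi> u \<otimes>\<^bsub>Q\<^esub> ((if s then \<psi> [(a, True)] else inv\<^bsub>Q\<^esub> \<psi> [(a, True)]) \<otimes>\<^bsub>Q\<^esub> \<psi> v) = \<one>\<^bsub>Q\<^esub>"
            using Q.hom_split[OF \<psi> r] \<psi>_R by simp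
          show "\<psi> u \<otimes>\<^bsub>Q\<^esub> ((if s then \<psi> c else inv\<^bsub>Q\<^esub> \<psi> c) \<otimes>\<^bsub>Q\<^esub> \<psi> v) = \<one>\<^bsub>Q\<^esub>"
            by (rule solve) (auto simp: \<psi>A assms)
        qed (use carr in auto)
        then have "\<psi> [(a, True)] = \<psi> c"
          using Q.inv_inj carr by (cases s) (auto simp: inj_on_eq_iff)
        then show ?thesis
          using True \<phi>_univ[OF \<psi>A, of c] \<psi>_R c \<phi>'_gen[OF uv(3)] by simp
      qed
    qed
    then show ?thesis by simp
  qed
  ultimately show ?case
    using \<phi>' by blast
qed

section \<open>From the retraction to the presented group\<close>

text \<open>Renaming letters commutes with \<open>inv_letter\<close>, and injectivity excludes new
  cancellations, so renaming commutes with \<open>reduce\<close>.\<close>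

lemma free_group_iso_image:
  assumes "inj f"
  shows "free_group A \<cong> free_group (f ` A)"
proof -
  define p where "p = map_prod f (id :: bool \<Rightarrow> bool)"
  let ?m = "map p"
  have il: "inv_letter (p x) = p (inv_letter x)" for x
    by (cases x) (simp add: inv_letter_def p_def)
  have inj: "inj p"
    using assms by (simp add: p_def prod.inj_map)
  have fst_p: "fst (p x) = f (fst x)" for x
    by (simp add: p_def)
  have cons: "cons_reduce (p x) (?m w) = ?m (cons_reduce x w)" for x w
    by (cases w) (auto simp: il inj_eq[OF inj])
  have red: "reduce (?m w) = ?m (reduce w)" for w
    by (induction w) (auto simp: reduce_Cons cons, simp add: reduce_def)
  have reduced: "reduced (?m w) \<longleftrightarrow> reduced w" for w
    by (induction w) (auto simp: reduced_Cons hd_map il inj_eq[OF inj])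
  have hom_m: "?m \<in> hom (free_group A) (free_group (f ` A))"
    by (rule homI) (auto simp: mem_free_group reduced red[symmetric] fst_p)
  have "bij_betw ?m (carrier (free_group A)) (carrier (free_group (f ` A)))"
  proof (rule bij_betw_imageI)
    show "inj_on ?m (carrier (free_group A))"
      using inj by (meson inj_mapI inj_on_subset subset_UNIV)
    have "w \<in> ?m ` carrier (free_group A)" if w: "w \<in> carrier (free_group (f ` A))" for w
    proof -
      have "set w \<subseteq> p ` (A \<times> UNIV)"
        using w by (force simp: mem_free_group p_def)
      then have "w \<in> ?m ` lists (A \<times> UNIV)"
        unfolding lists_image[symmetric] by auto
      then obtain v where v: "w = ?m v" "set v \<subseteq> A \<times> UNIV"
        by auto
      then have "v \<in> carrier (free_group A)"
        using w by (auto simp: mem_free_group reduced fst_p)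
      then show ?thesis using v by blast
    qed
    moreover have "?m ` carrier (free_group A) \<subseteq> carrier (free_group (f ` A))"
      using hom_m by (auto simp: hom_def)
    ultimately show "?m ` carrier (free_group A) = carrier (free_group (f ` A))"
      by blast
  qed
  then show ?thesis
    using hom_m by (auto simp: is_iso_def iso_def)
qed

text \<open>Makes the family of normal subgroups in the definition of \<open>normal_closure\<close>
  nonempty, so that its intersection is a subgroup.\<close>

lemma (in group) normal_carrier: "carrier G \<lhd> G"
  by (auto simp: normal_inv_iff subgroup_self)

lemma (in group) normal_normal_closure:
  assumes "R \<subseteq> carrier G"
  shows "normal_closure G R \<lhd> G"
  unfolding normal_inv_iff
proof (intro conjI ballI)
  show "subgroup (normal_closure G R) G"
    unfolding normal_closure_def using assms normal_carrier
    by (intro subgroups_Inter) (auto simp: normal_inv_iff)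
next
  fix x h assume "x \<in> carrier G" "h \<in> normal_closure G R"
  then show "x \<otimes> h \<otimes> inv x \<in> normal_closure G R"
    by (auto simp: normal_closure_def normal_inv_iff)
qed

lemma subset_normal_closure: "R \<subseteq> normal_closure G R"
  by (auto simp: normal_closure_def)

text \<open>With the presented group itself as test group, the kernel of the retraction onto
  \<open>free_group B\<close> is exactly the normal closure of \<open>R\<close>; the first
  isomorphism theorem then identifies the quotient with \<open>free_group B\<close>.\<close>

lemma collapsible_imp_free:
  fixes R :: "'a word set" and A :: "'a set"
  assumes "collapsible R" and R: "R \<subseteq> carrier (free_group A)"
  shows "is_free_group (presented_group A R)"
proof -
  let ?N = "normal_closure (free_group A) R" and ?Q = "presented_group A R"
  interpret F: group "free_group A" by (rule group_free_group)
  have N: "?N \<lhd> free_group A"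
    using R by (rule F.normal_normal_closure)
  then have Q: "group ?Q"
    unfolding presented_group_def by (rule normal.factorgroup_is_group)
  obtain B \<phi> where B: "B \<subseteq> A" and \<phi>: "\<phi> \<in> hom (free_group A) (free_group B)"
    and *: "\<forall>w\<in>carrier (free_group B). \<phi> w = w" "\<forall>r\<in>R. \<phi> r = []"
      "\<forall>\<psi>\<in>hom (free_group A) ?Q. (\<forall>r\<in>R. \<psi> r = \<one>\<^bsub>?Q\<^esub>) \<longrightarrow>
        (\<forall>w\<in>carrier (free_group A). \<psi> (\<phi> w) = \<psi> w)"
    using collapsible_retraction[OF assms Q] by (elim exE conjE) (rule that)
  have \<phi>_id: "\<phi> w = w" if "w \<in> carrier (free_group B)" for w
    using *(1) that by blast
  have \<phi>_R: "\<phi> r = []" if "r \<in> R" for r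
    using *(2) that by blast
  have \<phi>_univ: "\<psi> (\<phi> w) = \<psi> w" if "\<psi> \<in> hom (free_group A) ?Q"
    "\<forall>r\<in>R. \<psi> r = \<one>\<^bsub>?Q\<^esub>" "w \<in> carrier (free_group A)" for \<psi> w
    using *(3) that by blast
  interpret \<phi>: group_hom "free_group A" "free_group B" \<phi>
    using \<phi> by (intro group_hom.intro group_free_group group_hom_axioms.intro)
  let ?K = "kernel (free_group A) (free_group B) \<phi>"
  have "?N \<subseteq> ?K"
    using \<phi>.normal_kernel \<phi>_R R by (auto simp: normal_closure_def kernel_def)
  \<comment> \<open>The projection to the quotient kills \<open>R\<close>, hence factors through
    \<open>\<phi>\<close>. An \<open>x\<close> with \<open>\<phi> x = []\<close> therefore has the
    same coset as \<open>[]\<close>, namely \<open>?N\<close>.\<close>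
  moreover have "x \<in> ?N" if "x \<in> ?K" for x
  proof -
    let ?\<psi> = "\<lambda>w. ?N #>\<^bsub>free_group A\<^esub> w"
    have NS: "subgroup ?N (free_group A)"
      using N by (rule normal_imp_subgroup)
    have x: "x \<in> carrier (free_group A)" "\<phi> x = []"
      using that by (auto simp: kernel_def)
    have "?\<psi> \<in> hom (free_group A) ?Q"
      unfolding presented_group_def using N by (rule normal.r_coset_hom_Mod)
    moreover have "\<forall>r\<in>R. ?\<psi> r = \<one>\<^bsub>?Q\<^esub>"
      using subgroup.rcos_const[OF NS group_free_group] subset_normal_closure[of R]
      by (auto simp: presented_group_def FactGroup_def)
    ultimately have "?\<psi> [] = ?\<psi> x"
      using \<phi>_univ x by metis
    then have "?\<psi> x = ?N"
      using F.coset_mult_one[of ?N] subgroup.subset[OF NS] by simp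
    then show ?thesis
      using F.coset_join1[of ?N x] x NS by simp
  qed
  ultimately have "?N = ?K"
    by blast
  moreover have "\<phi> ` carrier (free_group A) = carrier (free_group B)"
    using free_group_mono[OF B] \<phi>_id \<phi>.hom_closed by force
  ultimately have "?Q \<cong> free_group B"
    using \<phi>.FactGroup_iso by (simp add: presented_group_def)
  \<comment> \<open>A basis has to consist of elements of the type of cosets.\<close>
  moreover have "free_group B \<cong> free_group ((\<lambda>b. {[(b, True)]}) ` B)"
    by (rule free_group_iso_image) (auto simp: inj_def)
  ultimately have "?Q \<cong> free_group ((\<lambda>b. {[(b, True)]}) ` B)"
    by (rule iso_trans)
  then have "free_group ((\<lambda>b. {[(b, True)]}) ` B) \<cong> ?Q"
    by (rule group.iso_sym[OF Q])
  then show ?thesis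
    unfolding is_free_group_def using Q by blast
qed



section \<open>Sparse sets of relators are collapsible\<close>

text \<open>The hypothesis speaks of all nonempty subsets, so \<open>R - {w}\<close> inherits it,
  and a single pair of a relator and a generator to eliminate has to be found.\<close>

lemma collapsible_if_sparse:
  fixes R :: "'a word set"
  assumes "finite R" and "\<And>w. w \<in> R \<Longrightarrow> length w \<le> 4"
    and "\<And>T. T \<subseteq> R \<Longrightarrow> T \<noteq> {} \<Longrightarrow> 2 * card T < card (\<Union>w\<in>T. fst ` set w)"
  shows "collapsible R"
  using assms
proof (induction R rule: finite_psubset_induct)
  case (psubset R)
  show ?case
  proof (cases "R = {}")
    case False
    define S where "S = (\<Union>w\<in>R. fst ` set w)"
    \<comment> \<open>Occurrences of \<open>a\<close> and of its inverse are counted together, with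
      multiplicity.\<close>
    define c where "c a = (\<Sum>w\<in>R. count_list (map fst w) a)" for a
    have S: "finite S"
      using psubset.hyps by (simp add: S_def)
    \<comment> \<open>Double counting of letter occurrences: the total is at most
      \<open>4 * card R < 2 * card S\<close>, so the average of \<open>c\<close> over
      \<open>S\<close> is below 2.\<close>
    have "(\<Sum>a\<in>S. c a) = (\<Sum>w\<in>R. \<Sum>a\<in>S. count_list (map fst w) a)"
      unfolding c_def by (rule sum.swap)
    also have "\<dots> = (\<Sum>w\<in>R. length w)"
    proof (rule sum.cong[OF refl])
      fix w assume "w \<in> R"
      then show "(\<Sum>a\<in>S. count_list (map fst w) a) = length w"
        using sum_count_set[of "map fst w" S] S by (auto simp: S_def)
    qed
    also have "\<dots> \<le> 4 * card R"
      using sum_bounded_above[of R length 4] psubset.prems(1) by simp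
    also have "\<dots> < 2 * card S"
      using psubset.prems(2)[of R] False by (simp add: S_def)
    finally have "\<not> (\<forall>a\<in>S. 2 \<le> c a)"
      using sum_bounded_below[of S 2 c] by force
    then obtain a where a: "a \<in> S" "c a \<le> 1"
      by fastforce
    then obtain w where w: "w \<in> R" "a \<in> fst ` set w"
      by (auto simp: S_def)
    \<comment> \<open>Since \<open>c a \<le> 1\<close> and \<open>w\<close> already contributes at
      least 1, \<open>a\<close> occurs once in \<open>w\<close> and in no other relator.\<close>
    have "c a = count_list (map fst w) a + (\<Sum>w\<in>R - {w}. count_list (map fst w) a)"
      unfolding c_def using psubset.hyps w(1) by (rule sum.remove)
    moreover have "count_list (map fst w) a > 0"
      using w(2) count_list_0_iff[of "map fst w" a] by (metis list.set_map neq0_conv)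
    ultimately have one: "count_list (map fst w) a = 1"
      and "(\<Sum>w\<in>R - {w}. count_list (map fst w) a) = 0"
      using a(2) by linarith+
    then have rest: "a \<notin> (\<Union>w\<in>R - {w}. fst ` set w)"
      using psubset.hyps by (auto simp: count_list_0_iff)
    obtain s where "(a, s) \<in> set w"
      using w(2) by auto
    then obtain u v where uv: "w = u @ (a, s) # v"
      by (meson split_list)
    then have "a \<notin> fst ` set (u @ v)"
      using one by (auto simp: count_list_0_iff)
    moreover have "collapsible (R - {w})"
      using w(1) psubset.prems by (intro psubset.IH) (auto intro: psubset.prems)
    ultimately have "collapsible (insert w (R - {w}))"
      unfolding uv using rest by (intro collapsible.insert) (auto simp: uv)
    then show ?thesis
      using w(1) by (simp add: insert_absorb)
  qed (simp add: collapsible.empty)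
qed

section \<open>Estimates for binomial coefficients\<close>

text \<open>\<open>k ^ k / fact k\<close> is a single term of the series for \<open>exp k\<close>,
  and \<open>exp 1 \<le> 3\<close>.\<close>

lemma power_self_le_fact: "real k ^ k \<le> 3 ^ k * fact k"
proof -
  have "real k ^ k /\<^sub>R fact k = (\<Sum>n\<in>{k}. real k ^ n /\<^sub>R fact n)"
    by simp
  also have "\<dots> \<le> exp (real k)"
    unfolding exp_def by (intro sum_le_suminf summable_exp_generic) auto
  also have "\<dots> = exp 1 ^ k"
    by (simp add: exp_of_nat_mult[symmetric])
  also have "\<dots> \<le> 3 ^ k"
    using exp_le by (intro power_mono) auto
  finally show ?thesis
    by (simp add: field_simps)
qed

lemma binomial_le_power_divide:
  assumes "k > 0"
  shows "real (n choose k) \<le> (3 * real n / real k) ^ k"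
proof -
  have "real (n choose k) * real k ^ k \<le> real (n choose k) * (3 ^ k * fact k)"
    by (intro mult_left_mono power_self_le_fact) auto
  also have "\<dots> = 3 ^ k * real ((n choose k) * fact k)"
    by simp
  also have "\<dots> \<le> 3 ^ k * real (n ^ k)"
    by (intro mult_left_mono of_nat_mono binomial_fact_pow) auto
  finally show ?thesis
    using assms by (simp add: power_divide power_mult_distrib field_simps)
qed

text \<open>A given \<open>k\<close>-set lies in a uniform \<open>m\<close>-subset of an
  \<open>N\<close>-set with probability the product of \<open>(m - i) / (N - i)\<close> over
  \<open>i < k\<close>. As \<open>m \<le> N\<close>, each factor is at most \<open>m / N\<close>.
  The bound is multiplied out to stay in the natural numbers.\<close>

lemma binomial_diff_mult_power_le:
  "k \<le> m \<Longrightarrow> m \<le> N \<Longrightarrow> (N - k choose (m - k)) * N ^ k \<le> (N choose m) * m ^ k"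
proof (induction k)
  case (Suc k)
  let ?C = "N - Suc k choose (m - Suc k)" and ?D = "N - k choose (m - k)"
  have nk: "N - k = Suc (N - Suc k)" "m - k = Suc (m - Suc k)"
    using Suc.prems by auto
  have "(N - k) * (?C * N) = N * ((m - k) * ?D)"
    using Suc_times_binomial_eq[of "N - Suc k" "m - Suc k"] nk by (simp add: algebra_simps)
  also have "\<dots> = (N * (m - k)) * ?D"
    by simp
  \<comment> \<open>After expanding, this is \<open>k * m \<le> k * N\<close>.\<close>
  also have "N * (m - k) \<le> m * (N - k)"
    using mult_le_mono2[OF Suc.prems(2), of k] by (simp add: diff_mult_distrib2 mult.commute diff_le_mono2)
  finally have "(N - k) * (?C * N) \<le> (N - k) * (m * ?D)"
    by (simp add: mult_ac)
  then have "?C * N \<le> m * ?D"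
    using nk(1) by (metis mult_le_cancel1 zero_less_Suc)
  then have "?C * N * N ^ k \<le> m * (?D * N ^ k)"
    by (metis mult.assoc mult_le_mono1)
  also have "\<dots> \<le> m * ((N choose m) * m ^ k)"
    using Suc by (intro mult_le_mono2) auto
  finally show ?case
    by (simp add: mult_ac)
qed simp

lemma card_supersets_le:
  assumes "finite W" "T \<subseteq> W" "k = card T"
  shows "card {R. T \<subseteq> R \<and> R \<subseteq> W \<and> card R = m} \<le> (card W - k) choose (m - k)"
proof -
  have T: "finite T"
    using assms finite_subset by blast
  have "card {R. T \<subseteq> R \<and> R \<subseteq> W \<and> card R = m} \<le> card {U. U \<subseteq> W - T \<and> card U = m - k}"
  proof (rule card_inj_on_le)
    show "inj_on (\<lambda>R. R - T) {R. T \<subseteq> R \<and> R \<subseteq> W \<and> card R = m}"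
      by (rule inj_onI) blast
    show "(\<lambda>R. R - T) ` {R. T \<subseteq> R \<and> R \<subseteq> W \<and> card R = m} \<subseteq> {U. U \<subseteq> W - T \<and> card U = m - k}"
      using T assms by (auto simp: card_Diff_subset)
    show "finite {U. U \<subseteq> W - T \<and> card U = m - k}"
      using assms by simp
  qed
  also have "\<dots> = (card W - k) choose (m - k)"
    using assms T by (simp add: n_subsets card_Diff_subset)
  finally show ?thesis .
qed

section \<open>Counting crowded sets of relators\<close>

text \<open>The failure of the inequality in \<open>collapsible_if_sparse\<close>. The empty set is
  crowded, so the bad event below asks for nonempty \<open>T\<close>.\<close>

definition crowded :: "'a word set \<Rightarrow> bool" where
  "crowded T \<longleftrightarrow> card (\<Union>w\<in>T. fst ` set w) \<le> 2 * card T"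

text \<open>Choose \<open>2 * k\<close> generators that contain all those used, then
  \<open>k\<close> words over them; there are \<open>(2 * (2 * k)) ^ 4\<close> words of length four
  over \<open>2 * k\<close> generators.\<close>

lemma card_crowded_le:
  assumes "2 * k \<le> n"
  shows "card {T. T \<subseteq> square_words n \<and> card T = k \<and> crowded T}
    \<le> (n choose (2 * k)) * ((4 * k) ^ 4 choose k)"
proof (cases "k = 0")
  case True
  then have "{T. T \<subseteq> square_words n \<and> card T = k \<and> crowded T} \<subseteq> {{}}"
    using finite_subset[OF _ finite_square_words[of n]] by auto
  then have "card {T. T \<subseteq> square_words n \<and> card T = k \<and> crowded T} \<le> card {{} :: nat word set}"
    by (intro card_mono) auto
  then show ?thesis
    using True by simp
next
  case False
  let ?L = "\<lambda>B. {w. set w \<subseteq> B \<times> (UNIV :: bool set) \<and> length w = 4}"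
  let ?\<B> = "{B. B \<subseteq> gens n \<and> card B = 2 * k}"
  have fg: "finite (gens n)" and cg: "card (gens n) = n"
    by (simp_all add: gens_def)
  have fB: "finite B" if "B \<in> ?\<B>" for B
    using that fg finite_subset by blast
  have fL: "finite (?L B)" "card (?L B) = (4 * k) ^ 4" if "B \<in> ?\<B>" for B
    using fB[OF that] that by (auto simp: finite_lists_length_eq card_lists_length_eq card_cartesian_product)
  have "{T. T \<subseteq> square_words n \<and> card T = k \<and> crowded T}
      \<subseteq> (\<Union>B\<in>?\<B>. {T. T \<subseteq> ?L B \<and> card T = k})"
  proof
    fix T assume "T \<in> {T. T \<subseteq> square_words n \<and> card T = k \<and> crowded T}"
    then have T: "T \<subseteq> square_words n" "card T = k" "card (\<Union>w\<in>T. fst ` set w) \<le> 2 * k"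
      by (auto simp: crowded_def)
    have "(\<Union>w\<in>T. fst ` set w) \<subseteq> gens n"
      using T(1) by (auto simp: square_words_def)
    \<comment> \<open>The generators in use may be fewer than \<open>2 * k\<close>; they can be
      filled up to exactly that number because \<open>2 * k \<le> n\<close>.\<close>
    then obtain B where B: "(\<Union>w\<in>T. fst ` set w) \<subseteq> B" "B \<subseteq> gens n" "card B = 2 * k"
      using exists_subset_between[of "\<Union>w\<in>T. fst ` set w" "2 * k" "gens n"] T(3) assms fg cg by auto
    then have "T \<subseteq> ?L B"
      using T(1) by (force simp: square_words_def)
    then show "T \<in> (\<Union>B\<in>?\<B>. {T. T \<subseteq> ?L B \<and> card T = k})"
      using B T(2) by blast
  qed
  then have "card {T. T \<subseteq> square_words n \<and> card T = k \<and> crowded T}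
      \<le> card (\<Union>B\<in>?\<B>. {T. T \<subseteq> ?L B \<and> card T = k})"
    using fg fL by (intro card_mono finite_UN_I) auto
  also have "\<dots> \<le> (\<Sum>B\<in>?\<B>. card {T. T \<subseteq> ?L B \<and> card T = k})"
    using fg by (intro card_UN_le) auto
  also have "\<dots> = (\<Sum>B\<in>?\<B>. (4 * k) ^ 4 choose k)"
    using fL by (intro sum.cong refl) (simp add: n_subsets)
  also have "\<dots> = (n choose (2 * k)) * ((4 * k) ^ 4 choose k)"
    using fg cg by (simp add: n_subsets)
  finally show ?thesis .
qed

text \<open>Positive words are cyclically reduced.\<close>

lemma card_square_words_ge: "n ^ 4 \<le> card (square_words n)"
proof -
  let ?P = "{w. set w \<subseteq> gens n \<times> {True} \<and> length w = 4}"
  have "card ?P = n ^ 4"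
    by (simp add: card_lists_length_eq card_cartesian_product gens_def)
  moreover have "?P \<subseteq> square_words n"
  proof
    fix w assume w: "w \<in> ?P"
    then have "snd x" if "x \<in> set w" for x
      using that by auto
    then have pos: "y \<noteq> inv_letter x" if "x \<in> set w" "y \<in> set w" for x y
      using that by (metis inv_letter_def snd_conv)
    have "reduced w"
      unfolding reduced_def using pos nth_mem by (metis Suc_lessD)
    moreover have "w \<noteq> []"
      using w by auto
    ultimately show "w \<in> square_words n"
      using w pos by (auto simp: square_words_def cyclically_reduced_def)
  qed
  ultimately show ?thesis
    using card_mono[OF finite_square_words, of ?P n] by linarith
qed

section \<open>The first moment bound\<close>

lemma sum_power_le:
  fixes q :: real
  assumes "0 \<le> q" "q \<le> 1 / 2"
  shows "(\<Sum>k = 1..m. q ^ k) \<le> 2 * q"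
proof -
  \<comment> \<open>The bound is strengthened for the induction: its right side grows by exactly
    \<open>q * (1 / 2) ^ m\<close>, which dominates the new term.\<close>
  have "(\<Sum>k = 1..m. q ^ k) \<le> 2 * q * (1 - (1 / 2) ^ m)"
  proof (induction m)
    case (Suc m)
    have "q ^ Suc m \<le> q * (1 / 2) ^ m"
      using assms power_mono[of q "1/2" m] by (simp add: mult_left_mono)
    then show ?case
      using Suc by (simp add: algebra_simps)
  qed simp
  also have "\<dots> \<le> 2 * q * 1"
    using assms by (intro mult_left_mono) auto
  finally show ?thesis by simp
qed

text \<open>The left side bounds the expected number of crowded \<open>k\<close>-sets: their count
  times the probability bound \<open>(m / N) ^ k\<close>. The binomial estimates turn each of the
  \<open>k\<close> factors into \<open>1728 * k * m / n\<^sup>2\<close>, where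
  \<open>1728 = (3 / 2)\<^sup>2 * 3 * 4 ^ 4\<close>, and \<open>k \<le> m\<close> finishes.\<close>

lemma expected_crowded_le:
  assumes "0 < k" "k \<le> m" "0 < n" "n ^ 4 \<le> N"
  shows "real ((n choose (2 * k)) * ((4 * k) ^ 4 choose k)) * (real m / real N) ^ k
    \<le> (1728 * (real m / real n)\<^sup>2) ^ k"
proof -
  have "real ((n choose (2 * k)) * ((4 * k) ^ 4 choose k)) * (real m / real N) ^ k
      \<le> (3 * real n / real (2 * k)) ^ (2 * k) * (3 * real ((4 * k) ^ 4) / real k) ^ k * (real m / real n ^ 4) ^ k"
    unfolding of_nat_mult[of "n choose _"] using assms
    by (intro mult_mono binomial_le_power_divide power_mono divide_left_mono)
      (auto simp flip: of_nat_power intro!: mult_pos_pos, 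
       metis assms(3) gr0I leD of_nat_0_less_iff zero_less_power)
  also have "\<dots> = (1728 * (real k * real m) / (real n)\<^sup>2) ^ k"
  proof -
    have "(3 * real n / real (2 * k))\<^sup>2 * (3 * real ((4 * k) ^ 4) / real k) * (real m / real n ^ 4)
      = 1728 * (real k * real m) / (real n)\<^sup>2"
      using assms by (simp add: field_simps power2_eq_square power4_eq_xxxx)
    then show ?thesis
      by (simp only: power_mult power_mult_distrib[symmetric])
  qed
  also have "\<dots> \<le> (1728 * (real m * real m) / (real n)\<^sup>2) ^ k"
    using assms by (intro power_mono divide_right_mono mult_left_mono mult_right_mono) auto
  also have "\<dots> = (1728 * (real m / real n)\<^sup>2) ^ k"
    by (simp add: power2_eq_square)
  finally show ?thesis .
qed

text \<open>Union bound over all crowded \<open>T\<close>, grouped by size \<open>k\<close>. The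
  bounds for the separate sizes form a geometric series of ratio \<open>q\<close>. The assumption
  \<open>2 * m \<le> n\<close> makes \<open>card_crowded_le\<close> applicable for every
  \<open>k \<le> m\<close>.\<close>

lemma prob_crowded_le:
  fixes n :: nat and d :: real
  defines "m \<equiv> nat \<lfloor>(2 * real n - 1) powr (4 * d)\<rfloor>"
  defines "q \<equiv> 1728 * (real m / real n)\<^sup>2"
  assumes n: "0 < n" and mn: "2 * m \<le> n" and q: "q \<le> 1 / 2"
  shows "measure_pmf.prob (square_model n d) {R. \<exists>T\<subseteq>R. T \<noteq> {} \<and> crowded T} \<le> 2 * q"
proof -
  let ?W = "square_words n" and ?X = "{R. \<exists>T\<subseteq>R. T \<noteq> {} \<and> crowded T}"
  let ?N = "card ?W"
  let ?D = "\<lambda>k. {T. T \<subseteq> ?W \<and> card T = k \<and> crowded T}"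
  let ?U = "\<lambda>T. {R. T \<subseteq> R \<and> R \<subseteq> ?W \<and> card R = m}"
  have nN: "n ^ 4 \<le> ?N"
    by (rule card_square_words_ge)
  have "n \<le> n ^ 4"
    using n by (intro self_le_power) auto
  then have mN: "m \<le> ?N" and N: "0 < ?N"
    using mn nN n by linarith+
  have rs: "relator_sets n d = {R. R \<subseteq> ?W \<and> card R = m}"
    by (simp add: relator_sets_def m_def)
  have crs: "card (relator_sets n d) = ?N choose m"
    unfolding rs by (simp add: n_subsets finite_square_words)
  \<comment> \<open>The sample space is nonempty, so \<open>pmf_of_set\<close> really is the uniform
    distribution on it and probabilities are quotients of cardinalities.\<close>
  then have pos: "0 < card (relator_sets n d)"
    using mN by simp
  have fD: "finite (?D k)" for k
    by (rule finite_subset[of _ "Pow ?W"]) (auto simp: finite_square_words)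
  have fU: "finite (?U T)" for T
    by (rule finite_subset[of _ "Pow ?W"]) (auto simp: finite_square_words)
  have "relator_sets n d \<inter> ?X \<subseteq> (\<Union>k\<in>{1..m}. \<Union>T\<in>?D k. ?U T)"
  proof
    fix R assume "R \<in> relator_sets n d \<inter> ?X"
    then obtain T where R: "R \<subseteq> ?W" "card R = m" and T: "T \<subseteq> R" "T \<noteq> {}" "crowded T"
      by (auto simp: rs)
    have "finite R"
      using R(1) finite_square_words by (rule finite_subset)
    then have "card T \<in> {1..m}"
      using T R(2) card_mono[of R T] finite_subset[of T R] by (auto simp: Suc_le_eq card_gt_0_iff)
    then show "R \<in> (\<Union>k\<in>{1..m}. \<Union>T\<in>?D k. ?U T)"
      using R T by blast
  qed
  then have "card (relator_sets n d \<inter> ?X) \<le> card (\<Union>k\<in>{1..m}. \<Union>T\<in>?D k. ?U T)"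
    using fD fU by (intro card_mono) auto
  also have "\<dots> \<le> (\<Sum>k = 1..m. card (\<Union>T\<in>?D k. ?U T))"
    by (intro card_UN_le) auto
  also have "\<dots> \<le> (\<Sum>k = 1..m. card (?D k) * (?N - k choose (m - k)))"
  proof (rule sum_mono)
    fix k
    have "card (\<Union>T\<in>?D k. ?U T) \<le> (\<Sum>T\<in>?D k. card (?U T))"
      using fD by (rule card_UN_le)
    also have "\<dots> \<le> (\<Sum>T\<in>?D k. (?N - k choose (m - k)))"
      by (intro sum_mono card_supersets_le finite_square_words) auto
    finally show "card (\<Union>T\<in>?D k. ?U T) \<le> card (?D k) * (?N - k choose (m - k))"
      by simp
  qed
  finally have "real (card (relator_sets n d \<inter> ?X)) \<le> (\<Sum>k = 1..m. real (card (?D k) * (?N - k choose (m - k))))"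
    unfolding of_nat_sum[symmetric] of_nat_le_iff .
  also have "\<dots> \<le> (\<Sum>k = 1..m. q ^ k * real (?N choose m))"
  proof (rule sum_mono)
    fix k assume k: "k \<in> {1..m}"
    have "real (?N - k choose (m - k)) * real ?N ^ k \<le> real (?N choose m) * real m ^ k"
      using binomial_diff_mult_power_le[of k m ?N] k mN by (metis atLeastAtMost_iff of_nat_mono of_nat_mult of_nat_power)
    then have b: "real (?N - k choose (m - k)) \<le> (real m / real ?N) ^ k * real (?N choose m)"
      using N by (simp add: power_divide field_simps)
    have "real (card (?D k) * (?N - k choose (m - k)))
        \<le> real ((n choose (2 * k)) * ((4 * k) ^ 4 choose k)) * ((real m / real ?N) ^ k * real (?N choose m))"
      unfolding of_nat_mult[of "card (?D k)"] using k mn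
      by (intro mult_mono of_nat_mono card_crowded_le b) auto
    also have "\<dots> \<le> q ^ k * real (?N choose m)"
      unfolding mult.assoc[symmetric] q_def using k n nN
      by (intro mult_right_mono expected_crowded_le) auto
    finally show "real (card (?D k) * (?N - k choose (m - k))) \<le> q ^ k * real (?N choose m)" .
  qed
  also have "\<dots> \<le> 2 * q * real (?N choose m)"
    unfolding sum_distrib_right[symmetric]
    using q by (intro mult_right_mono sum_power_le) (auto simp: q_def)
  finally have "real (card (relator_sets n d \<inter> ?X)) \<le> 2 * q * real (card (relator_sets n d))"
    by (simp add: crs)
  moreover have "measure_pmf.prob (square_model n d) ?X
      = real (card (relator_sets n d \<inter> ?X)) / real (card (relator_sets n d))"
    unfolding square_model_def using pos finite_relator_sets by (intro measure_pmf_of_set) auto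
  ultimately show ?thesis
    using pos by (simp add: divide_le_eq)
qed

section \<open>Freeness with overwhelming probability\<close>

lemma free_if_no_crowded:
  assumes "R \<subseteq> square_words n" "\<not> (\<exists>T\<subseteq>R. T \<noteq> {} \<and> crowded T)"
  shows "is_free_group (presented_group (gens n) R)"
proof (rule collapsible_imp_free)
  show "R \<subseteq> carrier (free_group (gens n))"
    using assms(1) square_words_subset by (rule subset_trans)
  show "collapsible R"
  proof (rule collapsible_if_sparse)
    show "finite R"
      using assms(1) finite_square_words by (rule finite_subset)
    show "length w \<le> 4" if "w \<in> R" for w
      using assms(1) that by (auto simp: square_words_def)
    show "2 * card T < card (\<Union>w\<in>T. fst ` set w)" if "T \<subseteq> R" "T \<noteq> {}" for T
      using assms(2) that unfolding crowded_def not_le[symmetric] by blast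
  qed
qed

theorem theorem4p8:
  fixes d :: real
  assumes "0 < d" and "d < 1 / 4"
  shows "overwhelming_probability_square d is_free_group"
proof -
  define m where "m n = nat \<lfloor>(2 * real n - 1) powr (4 * d)\<rfloor>" for n
  define P where "P n = measure_pmf.prob (square_model n d) {R. is_free_group (presented_group (gens n) R)}" for n
  \<comment> \<open>The density enters here: the exponent \<open>4 * d\<close> is below 1.\<close>
  have "(\<lambda>n. (2 * real n - 1) powr (4 * d) / real n) \<longlonglongrightarrow> 0"
    using assms by real_asymp
  then have m: "(\<lambda>n. real (m n) / real n) \<longlonglongrightarrow> 0"
    by (rule tendsto_sandwich[OF _ _ tendsto_const, rotated 2])
      (auto simp: m_def intro!: always_eventually divide_right_mono)
  define q where "q n = 1728 * (real (m n) / real n)\<^sup>2" for n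
  have q: "q \<longlonglongrightarrow> 0"
    unfolding q_def using tendsto_mult_left[OF tendsto_power[OF m, of 2], of 1728] by simp
  have half: "(0 :: real) < 1 / 2"
    by simp
  \<comment> \<open>Once \<open>m n / n\<close> and \<open>q n\<close> are both below
    \<open>1 / 2\<close>, the assumptions of \<open>prob_crowded_le\<close> hold.\<close>
  have "\<forall>\<^sub>F n in sequentially. 1 - 2 * q n \<le> P n"
    using eventually_gt_at_top[of 0] order_tendstoD(2)[OF m half] order_tendstoD(2)[OF q half]
  proof eventually_elim
    case (elim n)
    let ?X = "{R. \<exists>T\<subseteq>R. T \<noteq> {} \<and> crowded T}"
    have "measure_pmf.prob (square_model n d) ?X \<le> 2 * q n"
      using elim prob_crowded_le[of n d] by (simp add: q_def m_def field_simps)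
    moreover have "1 - measure_pmf.prob (square_model n d) ?X = measure_pmf.prob (square_model n d) (- ?X)"
      using measure_pmf.prob_compl[of ?X "square_model n d"] by (simp add: Compl_eq_Diff_UNIV)
    moreover have "measure_pmf.prob (square_model n d) (- ?X) \<le> P n"
      unfolding P_def
    \<comment> \<open>The inclusion of events is needed only on the support:
      \<open>free_if_no_crowded\<close> speaks only of sets of square words.\<close>
    proof (rule measure_pmf.finite_measure_mono_AE)
      have "set_pmf (square_model n d) = relator_sets n d"
        unfolding square_model_def using elim assms
        by (intro set_pmf_of_set relator_sets_nonempty finite_relator_sets) auto
      then show "AE R in measure_pmf (square_model n d). R \<in> - ?X \<longrightarrow>
          R \<in> {R. is_free_group (presented_group (gens n) R)}"
        using free_if_no_crowded[of _ n] by (auto simp: AE_measure_pmf_iff relator_sets_def)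
    qed simp
    ultimately show ?case by linarith
  qed
  moreover have "P n \<le> 1" for n
    by (simp add: P_def)
  moreover have "(\<lambda>n. 1 - 2 * q n) \<longlonglongrightarrow> 1"
    using tendsto_diff[OF tendsto_const tendsto_mult_left[OF q, of 2], of 1] by simp
  ultimately have "P \<longlonglongrightarrow> 1"
    using tendsto_sandwich[of "\<lambda>n. 1 - 2 * q n" P sequentially "\<lambda>_. 1" 1] by simp
  then show ?thesis
    by (simp add: overwhelming_probability_square_def P_def[abs_def])
qed

end
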